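(* Fix $k$ and the type parameters $(v_j,p_j)_{j\in[k]}$. There exists a constant $\delta\ge 1$ (an integer not depending on $B$ or on the vectors below) such that the following holds for every $B\in\mathbb N$, all $\vec y,\vec n\in\mathbb N^k$ (past accepted arrivals and estimated future arrivals), all $i,j\in[k]$, and every feasible solution $\vec x^\star$ for $(\vec y,\vec n)$ with $x_i^\star+1\le n_i$: if $\vec x^\star$ is locally optimal at $j$, then there exists $l\in\{0,1,\dots,\delta\}$ such that $\vec x'=\vec x^\star+e_i-l\,e_j$ is locally optimal at $j$.
   Context: $[k]=\{1,\dots,k\}$, $\mathbb N=\{0,1,2,\dots\}$, $e_j$ is the $j$-th canonical unit vector in $\mathbb R^k$. There are $k$ customer types; type $j$ has revenue $0\le v_j<1$ and show-up probability $p_j\in\mathbb Q\cap(0,1]$. The critical ratio is $q_j=v_j/p_j$, assumed to satisfy $q_j<1$ for all $j$. Types are ordered so that $q_1\ge\dots\ge q_k$, and if $q_j=q_{j+1}$ then $v_j>v_{j+1}$ and $p_j>p_{j+1}$. $B\in\mathbb N$ is the capacity. For $m\in\mathbb N$, $X_{j,m}\sim\mathrm{Bin}(m,p_j)$, independent across types $j$. Given $\vec y\in\mathbb N^k$ (customers of each type already accepted) and $\vec n\in\mathbb N^k$ (estimated numbers of future arrivals of each type), a *feasible solution* is $\vec x\in\mathbb N^k$ with $0\le x_j\le n_j$ for all $j$. A feasible solution $\vec x^\star$ is *locally optimal at* $j$ if $x_j^\star$ is the largest element of the set of maximizers, over integers $0\le x_j\le n_j$, of $$x_jv_j-\mathbb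 E\Big[\Big(X_{j,y_j+x_j}+\sum_{m\ne j}X_{m,y_m+x_m^\star}-B\Big)^+\Big].$$ *)

theory Defs
  imports "HOL-Probability.Probability"
begin

text \<open>
  Customer types are the indices in \<open>{1..k}\<close>; vectors indexed by the types are functions on
  \<^typ>\<open>nat\<close>, of which only the values on \<open>{1..k}\<close> matter.
\<close>

definition critical_ratio :: "(nat \<Rightarrow> real) \<Rightarrow> (nat \<Rightarrow> real) \<Rightarrow> nat \<Rightarrow> real" where
  "critical_ratio v p j = v j / p j"

definition customer_types :: "nat \<Rightarrow> (nat \<Rightarrow> real) \<Rightarrow> (nat \<Rightarrow> real) \<Rightarrow> bool" where
  "customer_types k v p \<longleftrightarrow>
     (\<forall>j\<in>{1..k}. 0 \<le> v j \<and> v j < 1 \<and> p j \<in> \<rat> \<and> 0 < p j \<and> p j \<le> 1 \<and> critical_ratio v p j < 1) \<and>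
     (\<forall>j\<in>{1..<k}. critical_ratio v p j \<ge> critical_ratio v p (j + 1) \<and>
        (critical_ratio v p j = critical_ratio v p (j + 1) \<longrightarrow> v j > v (j + 1) \<and> p j > p (j + 1)))"

text \<open>Joint law of the independent show-ups when \<open>c m\<close> customers of type \<open>m\<close> are accepted.\<close>

definition show_ups :: "nat \<Rightarrow> (nat \<Rightarrow> real) \<Rightarrow> (nat \<Rightarrow> nat) \<Rightarrow> (nat \<Rightarrow> nat) pmf" where
  "show_ups k p c = Pi_pmf {1..k} 0 (\<lambda>m. binomial_pmf (c m) (p m))"

definition expected_overflow :: "nat \<Rightarrow> (nat \<Rightarrow> real) \<Rightarrow> nat \<Rightarrow> (nat \<Rightarrow> nat) \<Rightarrow> real" where
  "expected_overflow k p B c =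
     measure_pmf.expectation (show_ups k p c) (\<lambda>X. max 0 ((\<Sum>m\<in>{1..k}. real (X m)) - real B))"

definition feasible :: "nat \<Rightarrow> (nat \<Rightarrow> nat) \<Rightarrow> (nat \<Rightarrow> nat) \<Rightarrow> bool" where
  "feasible k n x \<longleftrightarrow> (\<forall>m\<in>{1..k}. x m \<le> n m)"

definition local_objective ::
    "nat \<Rightarrow> (nat \<Rightarrow> real) \<Rightarrow> (nat \<Rightarrow> real) \<Rightarrow> nat \<Rightarrow> (nat \<Rightarrow> nat) \<Rightarrow> (nat \<Rightarrow> nat) \<Rightarrow> nat \<Rightarrow> nat \<Rightarrow> real" where
  "local_objective k v p B y x j z =
     real z * v j - expected_overflow k p B (\<lambda>m. y m + (x(j := z)) m)"

text \<open>The set under \<^const>\<open>Max\<close> is finite and nonempty, as \<open>z\<close> ranges over \<open>{0..n j}\<close>.\<close>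

definition locally_optimal ::
    "nat \<Rightarrow> (nat \<Rightarrow> real) \<Rightarrow> (nat \<Rightarrow> real) \<Rightarrow> nat \<Rightarrow> (nat \<Rightarrow> nat) \<Rightarrow> (nat \<Rightarrow> nat) \<Rightarrow> nat \<Rightarrow> (nat \<Rightarrow> nat) \<Rightarrow> bool" where
  "locally_optimal k v p B y n j x \<longleftrightarrow>
     feasible k n x \<and>
     x j = Max {z. is_arg_max (local_objective k v p B y x j) (\<lambda>z. z \<in> {0..n j}) z}"

definition canonical_unit :: "nat \<Rightarrow> nat \<Rightarrow> int" where
  "canonical_unit j m = (if m = j then 1 else 0)"

end

theory Submission
  imports Defs
begin

text \<open>
  Accepting one more customer of type \<open>j\<close> changes the objective by \<open>v j - p j * P(T \<ge> B)\<close>, where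
  \<open>T\<close> is the total number of show-ups, so local optimality compares the tail of \<open>T\<close> with the
  critical ratio \<open>q j\<close>. Adding a customer of type \<open>i\<close> raises \<open>T\<close> by at most one, hence it
  suffices that \<open>P(T + Bin(d, p j) \<ge> B) \<le> q j\<close> implies \<open>P(T \<ge> B - 1) \<le> q j\<close> once \<open>d\<close> is large.
  Let \<open>r = (1 - p j) ^ d\<close>. Replacing \<open>1\<close> by \<open>Bin(d, p j)\<close> loses at most \<open>r P(T = B - 1)\<close> and gains at
  least \<open>P(T = B - 2) / 2\<close>. If the loss prevails, then, \<open>T\<close> being log-concave as a sum of independent
  Bernoulli variables, its mass decays geometrically below \<open>B - 1\<close>, so that
  \<open>P(T \<ge> B - 1) \<ge> 1 - 4 r\<close> and \<open>P(T + Bin(d, p j) \<ge> B) \<ge> 1 - 5 r > q j\<close>.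
\<close>

section \<open>Laws of sums of independent Bernoulli variables\<close>

definition add_bernoulli :: "real \<Rightarrow> nat pmf \<Rightarrow> nat pmf" where
  "add_bernoulli p T = bind_pmf T (\<lambda>s. map_pmf (\<lambda>b. s + of_bool b) (bernoulli_pmf p))"

text \<open>The parameters may differ between summands, as the customer types require. The inductive
  form lets finite support and log-concavity be proved one summand at a time.\<close>

inductive bernoulli_sum :: "nat pmf \<Rightarrow> bool" where
  zero: "bernoulli_sum (return_pmf 0)"
| add: "bernoulli_sum T \<Longrightarrow> p \<in> {0..1} \<Longrightarrow> bernoulli_sum (add_bernoulli p T)"

lemma bernoulli_sum_funpow:
  "bernoulli_sum T \<Longrightarrow> p \<in> {0..1} \<Longrightarrow> bernoulli_sum ((add_bernoulli p ^^ d) T)"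
  by (induction d) (auto intro: bernoulli_sum.add)

lemma finite_set_pmf_bernoulli_sum: "bernoulli_sum T \<Longrightarrow> finite (set_pmf T)"
  by (induction rule: bernoulli_sum.induct) (auto simp: add_bernoulli_def)

lemma expectation_add_bernoulli:
  fixes f :: "nat \<Rightarrow> real"
  assumes T: "bernoulli_sum T" and p: "p \<in> {0..1}"
  shows "measure_pmf.expectation (add_bernoulli p T) f =
    (1 - p) * measure_pmf.expectation T f + p * measure_pmf.expectation T (\<lambda>s. f (Suc s))"
proof -
  note fin = finite_set_pmf_bernoulli_sum[OF T]
  have "measure_pmf.expectation (add_bernoulli p T) f =
    (\<Sum>s\<in>set_pmf T. pmf T s * (p * f (Suc s) + (1 - p) * f s))"
    unfolding add_bernoulli_def using p
    by (subst pmf_expectation_bind[OF fin]) (auto simp: fin mult.commute)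
  also have "\<dots> = (1 - p) * (\<Sum>s\<in>set_pmf T. pmf T s * f s) + p * (\<Sum>s\<in>set_pmf T. pmf T s * f (Suc s))"
    unfolding sum_distrib_left sum.distrib[symmetric] by (intro sum.cong refl) (simp add: algebra_simps)
  also have "\<dots> = (1 - p) * measure_pmf.expectation T f + p * measure_pmf.expectation T (\<lambda>s. f (Suc s))"
    by (simp add: integral_measure_pmf[OF fin])
  finally show ?thesis .
qed

lemma integrable_bernoulli_sum:
  "bernoulli_sum T \<Longrightarrow> integrable (measure_pmf T) (f :: nat \<Rightarrow> real)"
  by (rule integrable_measure_pmf_finite[OF finite_set_pmf_bernoulli_sum])

text \<open>Adding a Bernoulli variable to the law is dual to averaging the test function over the
  two outcomes. The outermost summand is moved first, hence \<open>f\<close> is arbitrary in the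
  induction.\<close>

lemma expectation_add_bernoulli_funpow:
  fixes f :: "nat \<Rightarrow> real"
  assumes "bernoulli_sum T" and "p \<in> {0..1}"
  shows "measure_pmf.expectation ((add_bernoulli p ^^ d) T) f =
    measure_pmf.expectation T (((\<lambda>g s. (1 - p) * g s + p * g (Suc s)) ^^ d) f)"
proof (induction d arbitrary: f)
  case (Suc d)
  have "bernoulli_sum ((add_bernoulli p ^^ d) T)"
    using assms by (rule bernoulli_sum_funpow)
  then have "measure_pmf.expectation ((add_bernoulli p ^^ Suc d) T) f =
      measure_pmf.expectation ((add_bernoulli p ^^ d) T) (\<lambda>s. (1 - p) * f s + p * f (Suc s))"
    using assms by (simp add: expectation_add_bernoulli integrable_bernoulli_sum)
  then show ?case
    by (simp add: Suc funpow_Suc_right del: funpow.simps)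
qed simp

lemma pmf_add_bernoulli:
  assumes "bernoulli_sum T" and "p \<in> {0..1}"
  shows "pmf (add_bernoulli p T) 0 = (1 - p) * pmf T 0"
    and "pmf (add_bernoulli p T) (Suc s) = (1 - p) * pmf T (Suc s) + p * pmf T s"
proof -
  have *: "pmf S a = measure_pmf.expectation S (indicat_real {a})" for S :: "nat pmf" and a
    by (simp add: measure_pmf_single)
  have "(\<lambda>s. indicat_real {0} (Suc s)) = (\<lambda>_. 0)" 
    "(\<lambda>t. indicat_real {Suc s} (Suc t)) = indicat_real {s}"
    by (auto simp: indicator_def)
  then show "pmf (add_bernoulli p T) 0 = (1 - p) * pmf T 0"
    and "pmf (add_bernoulli p T) (Suc s) = (1 - p) * pmf T (Suc s) + p * pmf T s"
    unfolding * expectation_add_bernoulli[OF assms] by (simp_all)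
qed

section \<open>Log-concavity and decay of the lower tail\<close>

text \<open>For \<open>a > 0\<close>, expand in \<open>p\<close> and \<open>1 - p\<close>: the
  square terms follow from \<open>f\<close>, and the mixed terms share
  \<open>f a * f (Suc b)\<close>, which leaves \<open>cross\<close>. Quantifying over
  \<open>a \<le> b\<close>, not only \<open>a = b\<close>, excludes internal zeros of
  \<open>f\<close>.\<close>

lemma log_concave_convolution:
  fixes f g :: "nat \<Rightarrow> real"
  assumes f: "\<And>a b. a \<le> b \<Longrightarrow> f a * f (Suc (Suc b)) \<le> f (Suc a) * f (Suc b)"
    and nonneg: "\<And>a. 0 \<le> f a" and p: "p \<in> {0..1}"
    and g: "g 0 = (1 - p) * f 0" "\<And>s. g (Suc s) = (1 - p) * f (Suc s) + p * f s"
    and "a \<le> b"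
  shows "g a * g (Suc (Suc b)) \<le> g (Suc a) * g (Suc b)"
proof (cases a)
  case 0
  have "(1 - p) * (1 - p) * (f 0 * f (Suc (Suc b))) \<le> (1 - p) * (1 - p) * (f (Suc 0) * f (Suc b))"
    using f[of 0 b] p by (intro mult_left_mono) auto
  moreover have "0 \<le> p * (1 - p) * (f (Suc 0) * f b) + p * p * (f 0 * f b)"
    using p nonneg by simp
  ultimately show ?thesis
    by (simp add: 0 g algebra_simps)
next
  case (Suc c)
  with \<open>a \<le> b\<close> obtain d where b: "b = Suc d" and "c \<le> d"
    by (cases b) auto
  have cross: "f c * f (Suc (Suc b)) \<le> f (Suc a) * f b"
  proof (cases "c = d")
    case True
    then show ?thesis using f[of c b] by (simp add: Suc b mult.commute)
  next
    \<comment> \<open>Now \<open>Suc c \<le> d\<close>, so two instances of \<open>f\<close> chain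
      through \<open>f a * f (Suc b)\<close>.\<close>
    case False
    with \<open>c \<le> d\<close> show ?thesis
      using f[of c b] f[of "Suc c" d] by (simp add: Suc b)
  qed
  have "(1 - p) * (1 - p) * (f a * f (Suc (Suc b))) \<le> (1 - p) * (1 - p) * (f (Suc a) * f (Suc b))"
    using f[of a b] p \<open>a \<le> b\<close> by (intro mult_left_mono) auto
  moreover have "p * p * (f c * f (Suc b)) \<le> p * p * (f a * f b)"
    using f[of c d] p \<open>c \<le> d\<close> unfolding Suc b by (intro mult_left_mono) auto
  moreover have "p * (1 - p) * (f c * f (Suc (Suc b))) \<le> p * (1 - p) * (f (Suc a) * f b)"
    using cross p by (intro mult_left_mono) auto
  ultimately show ?thesis
    by (simp add: Suc g b algebra_simps)
qed

lemma log_concave_bernoulli_sum: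
  assumes "bernoulli_sum T" and "a \<le> b"
  shows "pmf T a * pmf T (Suc (Suc b)) \<le> pmf T (Suc a) * pmf T (Suc b)"
  using assms
proof (induction arbitrary: a b rule: bernoulli_sum.induct)
  case zero
  then show ?case by simp
next
  case (add T p)
  show ?case
    using add.IH pmf_nonneg add.hyps(2) pmf_add_bernoulli[OF add.hyps] add.prems
    by (rule log_concave_convolution)
qed

text \<open>Log-concavity keeps the ratios \<open>f a / f (Suc a)\<close> from growing as
  \<open>a\<close> decreases, so the bound at \<open>b\<close> propagates downwards and a geometric
  series dominates the sum. The factor 2 bounds 1 / (1 - \<epsilon>).\<close>

lemma log_concave_lower_tail:
  fixes f :: "nat \<Rightarrow> real"
  assumes f: "\<And>a b. a \<le> b \<Longrightarrow> f a * f (Suc (Suc b)) \<le> f (Suc a) * f (Suc b)"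
    and nonneg: "\<And>a. 0 \<le> f a" and \<epsilon>: "0 \<le> \<epsilon>" "\<epsilon> \<le> 1 / 2"
    and step: "f b < \<epsilon> * f (Suc b)"
    and "a \<le> Suc b"
  shows "(\<Sum>s<a. f s) \<le> 2 * \<epsilon> * f a"
proof -
  \<comment> \<open>Strictness of \<open>step\<close> gives positivity, so that
    \<open>f (Suc b)\<close> can be cancelled in \<open>ratio\<close>.\<close>
  have pos: "0 < f (Suc b)"
    using step nonneg[of b] \<epsilon>(1) by (metis mult_nonneg_nonpos not_le order.strict_trans1 order.trans)
  have ratio: "f a \<le> \<epsilon> * f (Suc a)" if "a \<le> b" for a
  proof (cases "a = b")
    case False
    with that obtain c where c: "b = Suc c" "a \<le> c"
      by (cases b) auto
    have "f a * f (Suc b) \<le> f (Suc a) * f b"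
      using f[OF c(2)] by (simp add: c)
    also have "\<dots> \<le> f (Suc a) * (\<epsilon> * f (Suc b))"
      using step nonneg by (intro mult_left_mono) auto
    finally show ?thesis
      using pos by (simp add: algebra_simps)
  qed (use step in simp)
  show ?thesis
    using \<open>a \<le> Suc b\<close>
  proof (induction a)
    case 0
    then show ?case using \<epsilon> nonneg by simp
  next
    case (Suc a)
    have "2 * \<epsilon> * f a \<le> 1 * f a"
      using \<epsilon> nonneg by (intro mult_right_mono) auto
    with Suc ratio[of a] show ?case by simp
  qed
qed

section \<open>Comparison of tails after adding a binomial variable\<close>

text \<open>Here \<open>h d s = P(s + Bin(d, p) > b)\<close>.\<close>

lemma funpow_bernoulli_step:
  fixes p :: real and b :: nat
  assumes p: "p \<in> {0..1}"
  defines "L \<equiv> (\<lambda>g (s::nat). (1 - p) * g s + p * g (Suc s))"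
  defines "h \<equiv> (\<lambda>d. (L ^^ d) (indicat_real {Suc b..}))"
  shows "0 \<le> h d s" and "Suc b \<le> s \<Longrightarrow> h d s = 1" and "h d b = 1 - (1 - p) ^ d"
    and "Suc a = b \<Longrightarrow> h d a = 1 - (1 - p) ^ d - d * p * (1 - p) ^ (d - 1)"
proof -
  have hS: "h (Suc d) s = (1 - p) * h d s + p * h d (Suc s)" for d s
    by (simp add: h_def L_def)
  show "0 \<le> h d s" for s
    using p by (induction d arbitrary: s) (auto simp: hS, simp add: h_def)
  show 1: "Suc b \<le> s \<Longrightarrow> h d s = 1" for s d
    using p by (induction d arbitrary: s) (auto simp: hS, simp add: h_def)
  show 2: "h d b = 1 - (1 - p) ^ d" for d
  proof (induction d)
    case (Suc d)
    show ?case
      unfolding hS 1[OF le_refl] Suc.IH by (simp add: algebra_simps)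
  qed (simp add: h_def)
  \<comment> \<open>This is P(Bin(d, p) \<ge> 2): from \<open>a\<close> two successes are needed to
    exceed \<open>b\<close>. At \<open>d = 0\<close> the truncated \<open>d - 1\<close> is harmless
    because of the factor \<open>d\<close>.\<close>
  show "h d a = 1 - (1 - p) ^ d - d * p * (1 - p) ^ (d - 1)" if "Suc a = b"
  proof (induction d)
    case 0
    show ?case using that by (simp add: h_def)
  next
    case (Suc d)
    show ?case
      unfolding hS that 2 Suc.IH by (cases d) (simp_all add: algebra_simps)
  qed
qed

text \<open>Used with capacity \<open>Suc b\<close>. The conditions on \<open>d\<close> give 1 - 5r
  > q, allow the decay rate 2r \<le> 1/2, and make at least two successes as likely as not.\<close>

lemma tail_add_bernoulli_funpow:
  assumes T: "bernoulli_sum T" and p: "p \<in> {0..1}"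
    and q: "5 * (1 - p) ^ d < 1 - q" "(1 - p) ^ d \<le> 1 / 4"
    and d: "(1 - p) ^ d + d * p * (1 - p) ^ (d - 1) \<le> 1 / 2"
    and tail: "measure_pmf.prob ((add_bernoulli p ^^ d) T) {Suc b..} \<le> q"
  shows "measure_pmf.prob T {b..} \<le> q"
proof -
  define r where "r = (1 - p) ^ d"
  define h where "h = ((\<lambda>g (s::nat). (1 - p) * g s + p * g (Suc s)) ^^ d) (indicat_real {Suc b..})"
  note h = funpow_bernoulli_step[OF p, where d = d and b = b, folded h_def]
  have r: "0 \<le> r" "r \<le> 1 / 4" "5 * r < 1 - q"
    using p q by (auto simp: r_def)
  have hr: "h b = 1 - r" by (simp add: h r_def)
  have hhalf: "1 / 2 \<le> h a" if "Suc a = b" for a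
    unfolding h(4)[OF that] using d by linarith
  have tail_h: "measure_pmf.expectation T h \<le> q"
    using tail by (simp add: expectation_add_bernoulli_funpow[OF T p, symmetric] h_def)
  have int: "integrable (measure_pmf T) (f :: nat \<Rightarrow> real)" for f
    using T by (rule integrable_bernoulli_sum)
  \<comment> \<open>Each bound below comes from a suitable minorant of \<open>h\<close>.\<close>
  have mono: "measure_pmf.expectation T f \<le> q" if "\<And>s. f s \<le> h s" for f
    using tail_h integral_mono[OF int[of f] int[of h] that] by simp
  let ?P = "measure_pmf.prob T {b..}"
  have "measure_pmf.expectation T (\<lambda>s. (1 - r) * indicat_real {b..} s) \<le> q"
  proof (rule mono)
    fix s show "(1 - r) * indicat_real {b..} s \<le> h s"
      using h(1,2)[of s] hr r by (cases s b rule: linorder_cases) auto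
  qed
  then have crude: "(1 - r) * ?P \<le> q"
    by simp
  \<comment> \<open>The case split asks whether the gain at \<open>a\<close>, weighted by 1/2,
    covers the loss \<open>r * pmf T b\<close>.\<close>
  show ?thesis
  proof (cases "\<exists>a. Suc a = b \<and> 2 * r * pmf T b \<le> pmf T a")
    case True
    then obtain a where a: "Suc a = b" "2 * r * pmf T b \<le> pmf T a" by blast
    have "measure_pmf.expectation T (\<lambda>s. indicat_real {b..} s - r * indicat_real {b} s + 1/2 * indicat_real {a} s) \<le> q"
    proof (rule mono)
      fix s show "indicat_real {b..} s - r * indicat_real {b} s + 1/2 * indicat_real {a} s \<le> h s"
        using h(1,2)[of s] hr hhalf a(1) r by (cases s b rule: linorder_cases) (auto simp: indicator_def)
    qed
    then have "?P - r * pmf T b + 1/2 * pmf T a \<le> q"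
      by (simp add: int measure_pmf_single)
    with a show ?thesis by simp
  next
    case False
    \<comment> \<open>For \<open>b = 0\<close> there is no mass below \<open>b\<close>; otherwise
      the decay lemma applies with rate 2r, whence the factor 4.\<close>
    have "(\<Sum>s<b. pmf T s) \<le> 4 * r * pmf T b"
    proof (cases b)
      case (Suc a)
      with False have "pmf T a < 2 * r * pmf T (Suc a)" by auto
      with log_concave_lower_tail[where f="pmf T" and \<epsilon>="2 * r" and b=a and a=b, OF log_concave_bernoulli_sum[OF T]]
      show ?thesis using r Suc by simp
    qed (use r in simp)
    also have "\<dots> \<le> 4 * r * 1"
      using r by (intro mult_left_mono pmf_le_1) auto
    finally have "measure_pmf.prob T {..<b} \<le> 4 * r"
      by (simp add: measure_measure_pmf_finite)
    moreover have "?P = 1 - measure_pmf.prob T {..<b}"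
      using measure_pmf.prob_compl[of "{..<b}" T] by (simp add: Compl_eq_Diff_UNIV[symmetric])
    \<comment> \<open>Together with \<open>crude\<close> this gives 1 - 5r \<le> q, contradicting
      the choice of \<open>d\<close>.\<close>
    ultimately have "(1 - r) * (1 - 4 * r) \<le> (1 - r) * ?P"
      using r by (intro mult_left_mono) auto
    moreover have "1 - 5 * r \<le> (1 - r) * (1 - 4 * r)"
      using r by (simp add: algebra_simps)
    ultimately have False using crude r by linarith
    then show ?thesis ..
  qed
qed

text \<open>All three left-hand sides tend to 0. The form with "eventually" lets finitely many types
  share one \<open>d\<close>.\<close>

lemma eventually_tail_conditions:
  fixes p q :: real
  assumes "0 < p" "p \<le> 1" "q < 1"
  shows "\<forall>\<^sub>F d in sequentially. 5 * (1 - p) ^ d < 1 - q \<and> (1 - p) ^ d \<le> 1 / 4 \<and>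
    (1 - p) ^ d + d * p * (1 - p) ^ (d - 1) \<le> 1 / 2"
proof -
  have r: "(\<lambda>d. (1 - p) ^ d) \<longlonglongrightarrow> 0"
    using assms by (intro LIMSEQ_power_zero) auto
  \<comment> \<open>Shifting the index removes the truncated \<open>d - 1\<close> and exposes the
    null sequence n x^n.\<close>
  have "(\<lambda>d. (1 - p) ^ Suc d + (p * (real d * (1 - p) ^ d) + p * (1 - p) ^ d)) \<longlonglongrightarrow> 0 + (p * 0 + p * 0)"
    using assms by (intro tendsto_intros LIMSEQ_Suc[OF r] r powser_times_n_limit_0) auto
  then have "(\<lambda>d. (1 - p) ^ Suc d + Suc d * p * (1 - p) ^ (Suc d - 1)) \<longlonglongrightarrow> 0"
    by (simp add: algebra_simps)
  then have s: "(\<lambda>d. (1 - p) ^ d + d * p * (1 - p) ^ (d - 1)) \<longlonglongrightarrow> 0"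
    by (rule LIMSEQ_imp_Suc)
  have t: "(\<lambda>d. 5 * (1 - p) ^ d) \<longlonglongrightarrow> 0"
    using tendsto_mult_right_zero[OF r] .
  have "\<forall>\<^sub>F d in sequentially. 5 * (1 - p) ^ d < 1 - q"
    using order_tendstoD(2)[OF t, of "1 - q"] assms by simp
  moreover have "\<forall>\<^sub>F d in sequentially. (1 - p) ^ d < 1 / 4"
    by (rule order_tendstoD(2)[OF r]) simp
  moreover have "\<forall>\<^sub>F d in sequentially. (1 - p) ^ d + d * p * (1 - p) ^ (d - 1) < 1 / 2"
    by (rule order_tendstoD(2)[OF s]) simp
  ultimately show ?thesis
    by eventually_elim simp
qed

section \<open>The total number of show-ups and the marginal cost of a customer\<close>

definition total_show_ups :: "nat \<Rightarrow> (nat \<Rightarrow> real) \<Rightarrow> (nat \<Rightarrow> nat) \<Rightarrow> nat pmf" where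
  "total_show_ups k p c = map_pmf (\<lambda>X. \<Sum>m\<in>{1..k}. X m) (show_ups k p c)"

text \<open>By independence type \<open>j\<close> can be drawn last, which prepares for splitting
  one trial off its binomial.\<close>

lemma total_show_ups_remove:
  assumes "j \<in> {1..k}"
  shows "total_show_ups k p c =
    bind_pmf (Pi_pmf ({1..k} - {j}) 0 (\<lambda>m. binomial_pmf (c m) (p m)))
      (\<lambda>f. map_pmf (\<lambda>a. a + (\<Sum>m\<in>{1..k} - {j}. f m)) (binomial_pmf (c j) (p j)))"
proof -
  let ?A = "{1..k} - {j}"
  have k: "{1..k} = insert j ?A" using assms by auto
  have "(\<Sum>m\<in>insert j ?A. (f(j := a)) m) = a + (\<Sum>m\<in>?A. f m)" for f and a :: nat
    by (subst sum.insert) (auto intro!: sum.cong)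
  then show ?thesis
    unfolding total_show_ups_def show_ups_def
    by (subst (1 2) k)
      (simp add: Pi_pmf_insert' map_pmf_def bind_assoc_pmf bind_return_pmf
        bind_commute_pmf[of "binomial_pmf (c j) (p j)"] del: insert_Diff_single)
qed

lemma total_show_ups_Suc:
  assumes j: "j \<in> {1..k}" and p: "p j \<in> {0..1}"
  shows "total_show_ups k p (c(j := Suc (c j))) = add_bernoulli (p j) (total_show_ups k p c)"
proof -
  have *: "Pi_pmf ({1..k} - {j}) 0 (\<lambda>m. binomial_pmf ((c(j := Suc (c j))) m) (p m)) =
      Pi_pmf ({1..k} - {j}) 0 (\<lambda>m. binomial_pmf (c m) (p m))"
    by (rule Pi_pmf_cong) auto
  show ?thesis
    unfolding total_show_ups_remove[OF j] * add_bernoulli_def bind_assoc_pmf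
  proof (rule bind_pmf_cong[OF refl], goal_cases)
    case (1 f)
    show ?case
      \<comment> \<open>The binomial recursion draws the extra trial first,
        \<open>add_bernoulli\<close> draws it last; independent draws commute.\<close>
      by (simp add: binomial_pmf_Suc[OF p] map_pmf_def bind_assoc_pmf bind_return_pmf)
        (subst bind_commute_pmf, auto simp: of_bool_def intro!: bind_pmf_cong)
  qed
qed

lemma total_show_ups_add:
  assumes "j \<in> {1..k}" and "p j \<in> {0..1}"
  shows "total_show_ups k p (c(j := c j + d)) = (add_bernoulli (p j) ^^ d) (total_show_ups k p c)"
proof (induction d)
  case (Suc d)
  let ?c = "c(j := c j + d)"
  have "c(j := c j + Suc d) = ?c(j := Suc (?c j))"
    by simp
  then show ?case
    using total_show_ups_Suc[where p=p and c="?c", OF assms] Suc.IH by (simp only: funpow.simps comp_apply)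
qed simp

lemma bernoulli_sum_total_show_ups:
  assumes p: "\<And>m. m \<in> {1..k} \<Longrightarrow> p m \<in> {0..1}"
  shows "bernoulli_sum (total_show_ups k p c)"
proof (induction "\<Sum>m\<in>{1..k}. c m" arbitrary: c)
  case 0
  then have "Pi_pmf {1..k} 0 (\<lambda>m. binomial_pmf (c m) (p m)) = Pi_pmf {1..k} 0 (\<lambda>m. return_pmf 0)"
    using p by (intro Pi_pmf_cong) (auto simp: binomial_pmf_0)
  then show ?case
    by (simp add: total_show_ups_def show_ups_def bernoulli_sum.zero)
next
  case (Suc n)
  then obtain j where j: "j \<in> {1..k}" "c j \<noteq> 0"
    by (metis sum.neutral nat.distinct(1))
  define c' where "c' = c(j := c j - 1)"
  have c: "c = c'(j := Suc (c' j))"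
    using j by (auto simp: c'_def)
  have "(\<Sum>m\<in>{1..k} - {j}. c' m) = (\<Sum>m\<in>{1..k} - {j}. c m)"
    by (intro sum.cong) (auto simp: c'_def)
  then have "(\<Sum>m\<in>{1..k}. c m) = Suc (\<Sum>m\<in>{1..k}. c' m)"
    using j sum.remove[of "{1..k}" j c] sum.remove[of "{1..k}" j c'] by (simp add: c'_def)
  then show ?case
    using Suc j p by (subst c) (auto simp: total_show_ups_Suc intro!: bernoulli_sum.add)
qed

text \<open>One more show-up raises the overflow by exactly 1 when s \<ge> B and by 0
  otherwise.\<close>

lemma expected_overflow_Suc:
  assumes p: "\<And>m. m \<in> {1..k} \<Longrightarrow> p m \<in> {0..1}" and j: "j \<in> {1..k}"
  shows "expected_overflow k p B (c(j := Suc (c j))) =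
    expected_overflow k p B c + p j * measure_pmf.prob (total_show_ups k p c) {B..}"
proof -
  let ?T = "total_show_ups k p c" and ?f = "\<lambda>s. max 0 (real s - real B)"
  have T: "bernoulli_sum ?T"
    using p by (rule bernoulli_sum_total_show_ups)
  have eo: "expected_overflow k p B c = measure_pmf.expectation (total_show_ups k p c) ?f" for c
    by (simp add: expected_overflow_def total_show_ups_def)
  have "(\<lambda>s. ?f (Suc s)) = (\<lambda>s. ?f s + indicat_real {B..} s)"
    by (auto simp: indicator_def)
  then have "measure_pmf.expectation ?T (\<lambda>s. ?f (Suc s)) =
      measure_pmf.expectation ?T ?f + measure_pmf.prob ?T {B..}"
    by (simp add: integrable_bernoulli_sum[OF T])
  then show ?thesis
    unfolding eo using p[OF j] j
    by (simp add: total_show_ups_Suc expectation_add_bernoulli[OF T] algebra_simps)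
qed

text \<open>At \<open>b = 0\<close> truncation gives \<open>b - 1 = 0\<close>, and both tails are 1,
  so no case is excluded.\<close>

lemma prob_add_bernoulli:
  assumes "bernoulli_sum T" and "p \<in> {0..1}"
  shows "measure_pmf.prob (add_bernoulli p T) {b..} =
    (1 - p) * measure_pmf.prob T {b..} + p * measure_pmf.prob T {b - 1..}"
proof -
  have "(\<lambda>s. indicat_real {b..} (Suc s)) = indicat_real {b - 1..}"
    by (auto simp: indicator_def fun_eq_iff)
  then show ?thesis
    using expectation_add_bernoulli[OF assms, of "indicat_real {b..}"] by simp
qed

lemma prob_add_bernoulli_bounds:
  assumes "bernoulli_sum T" and "p \<in> {0..1}"
  shows "measure_pmf.prob T {b..} \<le> measure_pmf.prob (add_bernoulli p T) {b..}"
    and "measure_pmf.prob (add_bernoulli p T) {b..} \<le> measure_pmf.prob T {b - 1..}"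
proof -
  have le: "measure_pmf.prob T {b..} \<le> measure_pmf.prob T {b - 1..}"
    by (intro measure_pmf.finite_measure_mono) auto
  show "measure_pmf.prob T {b..} \<le> measure_pmf.prob (add_bernoulli p T) {b..}"
    using mult_left_mono[OF le, of p] assms(2)
    by (simp add: prob_add_bernoulli[OF assms] algebra_simps)
  show "measure_pmf.prob (add_bernoulli p T) {b..} \<le> measure_pmf.prob T {b - 1..}"
    using mult_left_mono[OF le, of "1 - p"] assms(2)
    by (simp add: prob_add_bernoulli[OF assms] algebra_simps)
qed

section \<open>Local optimality as a threshold condition\<close>

text \<open>Choosing the largest maximizer makes the comparison with the right neighbour strict.
  Neighbours suffice later, because the tail probability is monotone in the number accepted.\<close>

lemma Max_is_arg_max:
  fixes g :: "nat \<Rightarrow> real" and N :: nat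
  defines "z \<equiv> Max {z. is_arg_max g (\<lambda>z. z \<in> {0..N}) z}"
  shows "z \<le> N" and "0 < z \<Longrightarrow> g (z - 1) \<le> g z" and "z < N \<Longrightarrow> g (Suc z) < g z"
proof -
  let ?M = "{z. is_arg_max g (\<lambda>z. z \<in> {0..N}) z}"
  have M: "?M = {z \<in> {0..N}. \<forall>y \<in> {0..N}. g y \<le> g z}"
    by (auto simp: is_arg_max_def not_less)
  have fin: "finite ?M"
    unfolding M by simp
  have "Max (g ` {0..N}) \<in> g ` {0..N}"
    by (intro Max_in) auto
  then obtain w where w: "w \<in> {0..N}" "g w = Max (g ` {0..N})"
    by (metis imageE)
  then have "w \<in> ?M"
    unfolding M by auto
  then have z: "z \<in> ?M"
    unfolding z_def using fin by (intro Max_in) auto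
  then show "z \<le> N" "0 < z \<Longrightarrow> g (z - 1) \<le> g z"
    unfolding M by auto
  assume "z < N"
  have "Suc z \<notin> ?M"
    using Max_ge[OF fin, of "Suc z"] unfolding z_def[symmetric] by auto
  with z \<open>z < N\<close> show "g (Suc z) < g z"
    unfolding M by (auto simp: not_le dest: order.strict_trans2)
qed

lemma Max_local_objective:
  fixes y n x :: "nat \<Rightarrow> nat" and B :: nat
  assumes p: "\<And>m. m \<in> {1..k} \<Longrightarrow> p m \<in> {0..1}" and j: "j \<in> {1..k}" and "0 < p j"
  defines "P \<equiv> \<lambda>x z. measure_pmf.prob (total_show_ups k p ((\<lambda>m. y m + x m)(j := y j + z))) {B..}"
  assumes z: "z = Max {z. is_arg_max (local_objective k v p B y x j) (\<lambda>z. z \<in> {0..n j}) z}"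
  shows "z \<le> n j" and "0 < z \<Longrightarrow> P x (z - 1) \<le> v j / p j" and "z < n j \<Longrightarrow> v j / p j < P x z"
proof -
  let ?c = "\<lambda>z. (\<lambda>m. y m + x m)(j := y j + z)"
  have c: "(\<lambda>m. y m + (x(j := z)) m) = ?c z" for z
    by auto
  have incr: "local_objective k v p B y x j (Suc z) = local_objective k v p B y x j z + v j - p j * P x z" for z
    using expected_overflow_Suc[OF p j, where B=B and c="?c z"]
    unfolding local_objective_def c P_def by (simp add: algebra_simps)
  note m = Max_is_arg_max[of "local_objective k v p B y x j" "n j", folded z]
  show "z \<le> n j" by (rule m)
  show "P x (z - 1) \<le> v j / p j" if "0 < z"
    using m(2)[OF that] incr[of "z - 1"] that \<open>0 < p j\<close> by (simp add: field_simps)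
  show "v j / p j < P x z" if "z < n j"
    using m(3)[OF that] incr[of z] \<open>0 < p j\<close> by (simp add: field_simps)
qed

theorem lemma2:
  fixes k :: nat and v p :: "nat \<Rightarrow> real"
  assumes "customer_types k v p"
  shows "\<exists>\<delta>::nat. \<delta> \<ge> 1 \<and>
    (\<forall>(B::nat) (y::nat \<Rightarrow> nat) (n::nat \<Rightarrow> nat). \<forall>i\<in>{1..k}. \<forall>j\<in>{1..k}. \<forall>x::nat \<Rightarrow> nat.
       feasible k n x \<longrightarrow> x i + 1 \<le> n i \<longrightarrow> locally_optimal k v p B y n j x \<longrightarrow>
       (\<exists>l\<in>{0..\<delta>}. \<exists>x'::nat \<Rightarrow> nat.
          (\<forall>m\<in>{1..k}. int (x' m) = int (x m) + canonical_unit i m - int l * canonical_unit j m) \<and>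
          locally_optimal k v p B y n j x'))"
proof -
  have types: "0 < p j" "p j \<le> 1" "v j / p j < 1" if "j \<in> {1..k}" for j
    using assms that unfolding customer_types_def critical_ratio_def by blast+
  then have p: "p j \<in> {0..1}" if "j \<in> {1..k}" for j
    using that by (auto intro: less_imp_le)
  \<comment> \<open>The conditions involve only \<open>p\<close> and \<open>v\<close>, so the
    resulting \<delta> is independent of \<open>B\<close>, \<open>y\<close> and
    \<open>n\<close>.\<close>
  have "\<forall>\<^sub>F d in sequentially. \<forall>j\<in>{1..k}. 5 * (1 - p j) ^ d < 1 - v j / p j \<and> (1 - p j) ^ d \<le> 1 / 4 \<and>
    (1 - p j) ^ d + d * p j * (1 - p j) ^ (d - 1) \<le> 1 / 2"
    by (intro eventually_ball_finite ballI eventually_tail_conditions types) auto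
  then have "\<forall>\<^sub>F d in sequentially. d \<ge> 1 \<and> (\<forall>j\<in>{1..k}. 5 * (1 - p j) ^ d < 1 - v j / p j \<and> (1 - p j) ^ d \<le> 1 / 4 \<and>
    (1 - p j) ^ d + d * p j * (1 - p j) ^ (d - 1) \<le> 1 / 2)"
    by (intro eventually_conj eventually_ge_at_top)
  then obtain \<delta> where "\<delta> \<ge> 1" and \<delta>: "\<And>j. j \<in> {1..k} \<Longrightarrow> 5 * (1 - p j) ^ \<delta> < 1 - v j / p j"
      "\<And>j. j \<in> {1..k} \<Longrightarrow> (1 - p j) ^ \<delta> \<le> 1 / 4"
      "\<And>j. j \<in> {1..k} \<Longrightarrow> (1 - p j) ^ \<delta> + \<delta> * p j * (1 - p j) ^ (\<delta> - 1) \<le> 1 / 2"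
    by (auto simp: eventually_sequentially)
  show ?thesis
  proof (intro exI[of _ \<delta>] conjI allI ballI impI)
    show "\<delta> \<ge> 1" by fact
  next
    fix B y n i j x
    assume i: "i \<in> {1..k}" and j: "j \<in> {1..k}" and feas: "feasible k n x" and xi: "x i + 1 \<le> n i"
      and opt: "locally_optimal k v p B y n j x"
    show "\<exists>l\<in>{0..\<delta>}. \<exists>x'. (\<forall>m\<in>{1..k}. int (x' m) = int (x m) + canonical_unit i m - int l * canonical_unit j m) \<and>
          locally_optimal k v p B y n j x'"
    proof (cases "i = j")
      case True
      then show ?thesis
        \<comment> \<open>For \<open>i = j\<close> and \<open>l = 1\<close> the two unit vectors
          cancel, so \<open>x\<close> itself is the witness.\<close>
        using opt \<open>\<delta> \<ge> 1\<close> by (intro bexI[of _ 1] exI[of _ x]) auto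
    next
      case False
      \<comment> \<open>\<open>w\<close> adds the customer of type \<open>i\<close>, and
        \<open>z\<close> is the new optimum at \<open>j\<close>. The witness is
        \<open>l = x j - z\<close>, so \<open>z \<le> x j \<le> z + \<delta>\<close> has to be
        shown.\<close>
      define w where "w = x(i := Suc (x i))"
      define z where "z = Max {z. is_arg_max (local_objective k v p B y w j) (\<lambda>z. z \<in> {0..n j}) z}"
      define S where "S x z = total_show_ups k p ((\<lambda>m. y m + x m)(j := y j + z))" for x z
      define P where "P x z = measure_pmf.prob (S x z) {B..}" for x z
      have S: "bernoulli_sum (S x z)" for x z
        unfolding S_def by (rule bernoulli_sum_total_show_ups[OF p])
      have S_add: "S x (z + d) = (add_bernoulli (p j) ^^ d) (S x z)" for x z d
        unfolding S_def
        using total_show_ups_add[where p=p, OF j p[OF j], where c="(\<lambda>m. y m + x m)(j := y j + z)" and d=d]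
        by (simp add: add.assoc)
      have S_w: "S w z = add_bernoulli (p i) (S x z)" for z
      proof -
        have "(\<lambda>m. y m + w m)(j := y j + z) =
            ((\<lambda>m. y m + x m)(j := y j + z))(i := Suc (((\<lambda>m. y m + x m)(j := y j + z)) i))"
          using False by (auto simp: w_def)
        then show ?thesis
          unfolding S_def by (simp only: total_show_ups_Suc[where p=p, OF i p[OF i]])
      qed
      have P_mono: "P x z \<le> P x z'" if "z \<le> z'" for x z z'
        using that
      proof (induction rule: dec_induct)
        case (step z')
        then show ?case
          using prob_add_bernoulli_bounds(1)[where T="S x z'" and b=B, OF S p[OF j]] S_add[of x z' 1]
          unfolding P_def by simp
      qed simp
      have P_w: "P x z \<le> P w z" for z
        unfolding P_def S_w by (rule prob_add_bernoulli_bounds(1)[OF S p[OF i]])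
      have xj: "x j = Max {z. is_arg_max (local_objective k v p B y x j) (\<lambda>z. z \<in> {0..n j}) z}"
        using opt by (simp add: locally_optimal_def)
      note ox = Max_local_objective[where p=p and k=k and v=v and B=B and y=y and n=n and j=j and x=x and z="x j", OF p j types(1)[OF j] xj, folded S_def, folded P_def]
      note ow = Max_local_objective[where p=p and k=k and v=v and B=B and y=y and n=n and j=j and x=w and z="z", OF p j types(1)[OF j] z_def, folded S_def, folded P_def]
      \<comment> \<open>The extra customer can only raise the tail, so accepting beyond
        \<open>x j\<close>, where the threshold was already exceeded, cannot become optimal.\<close>
      have "z \<le> x j"
      proof (rule ccontr)
        assume "\<not> z \<le> x j"
        then have "v j / p j < P x (x j)" "P w (z - 1) \<le> v j / p j" "P w (x j) \<le> P w (z - 1)"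
          using ow(1,2) ox(3) P_mono[of "x j" "z - 1" w] by auto
        then show False
          using P_w[of "x j"] by simp
      qed
      \<comment> \<open>Otherwise the tail is still below the threshold with \<delta> extra
        customers of type \<open>j\<close>; then so is the tail from \<open>B - 1\<close> without
        them, which bounds the tail of \<open>w\<close> at \<open>z\<close>, although
        \<open>z\<close> being optimal below \<open>n j\<close> puts that above the
        threshold.\<close>
      moreover have "x j \<le> z + \<delta>"
      proof (rule ccontr)
        assume less: "\<not> x j \<le> z + \<delta>"
        have "P x (z + \<delta>) \<le> P x (x j - 1)"
          using less by (intro P_mono) simp
        also have "\<dots> \<le> v j / p j"
          using less by (intro ox(2)) auto
        finally have "P x (z + \<delta>) \<le> v j / p j" .
        then have le: "measure_pmf.prob ((add_bernoulli (p j) ^^ \<delta>) (S x z)) {B..} \<le> v j / p j"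
          by (simp add: P_def S_add)
        have "measure_pmf.prob (S x z) {B - 1..} \<le> v j / p j"
        proof (cases B)
          \<comment> \<open>Here \<open>B - 1 = 0\<close>, and both tails equal 1.\<close>
          case 0
          then show ?thesis using le by (simp add: atLeast_0)
        next
          case (Suc b)
          then show ?thesis
            using tail_add_bernoulli_funpow[OF S p[OF j] \<delta>[OF j]] le by simp
        qed
        moreover have "v j / p j < P w z"
          using less ox(1) by (intro ow(3)) auto
        ultimately show False
          using prob_add_bernoulli_bounds(2)[where T="S x z" and b=B, OF S p[OF i]]
          by (simp add: P_def S_w)
      qed
      \<comment> \<open>The objective at \<open>j\<close> overwrites coordinate \<open>j\<close>, so
        \<open>z\<close> remains the largest maximizer after the update.\<close>
      moreover have "locally_optimal k v p B y n j (w(j := z))"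
      proof -
        have "local_objective k v p B y (w(j := z)) j = local_objective k v p B y w j"
          by (simp add: local_objective_def fun_eq_iff)
        moreover have "feasible k n (w(j := z))"
          using feas xi ow(1) by (auto simp: feasible_def w_def)
        ultimately show ?thesis
          by (simp add: locally_optimal_def z_def)
      qed
      ultimately show ?thesis
        using False
        by (intro bexI[of _ "x j - z"] exI[of _ "w(j := z)"])
          (auto simp: w_def canonical_unit_def of_nat_diff)
    qed
  qed
qed

end
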